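(* Let $\phi_\mu(x),\tilde\phi_\mu(x)$ and $\psi^{\mu\nu}(x),\tilde\psi^{\mu\nu}(x)$ be smooth real functions on $\mathcal X$ with $\psi^{\mu\nu}=-\psi^{\nu\mu}$ and $\tilde\psi^{\mu\nu}=-\tilde\psi^{\nu\mu}$. Consider on the multisymplectic manifold $(\mathcal M_{\mathrm{Maxwell}},\Omega^{\mathrm{DDW}})$ the algebraic observable $(n-1)$-forms $$P_\phi=\phi_\mu(x)\,\pi^{A_\mu\nu}\,d\mathfrak y_\nu,\qquad Q^\psi=\tfrac12\,\psi^{\mu\nu}(x)\,A\wedge d\mathfrak y_{\mu\nu},$$ and similarly $P_{\tilde\phi}$, $Q^{\tilde\psi}$. Then their Poisson brackets are $$\{Q^{\psi},Q^{\tilde\psi}\}=0,\qquad \{P_\phi,P_{\tilde\phi}\}=0,\qquad \{Q^\psi,P_\phi\}=-\psi^{\mu\nu}(x)\,\phi_\mu(x)\,d\mathfrak y_\nu .$$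
   Context: Repeated indices are summed. $\mathcal X$ is Minkowski space-time of dimension $n=4$ with global coordinates $x^\mu$. The form $d\mathfrak y=dx^1\wedge\cdots\wedge dx^n$ is the volume form; $d\mathfrak y_\nu=\frac{\partial}{\partial x^\nu}\lrcorner\, d\mathfrak y$; $d\mathfrak y_{\mu\nu}=\frac{\partial}{\partial x^\mu}\lrcorner\frac{\partial}{\partial x^\nu}\lrcorner\, d\mathfrak y$. Here $\lrcorner$ is the interior product. $\mathcal M_{\mathrm{DDW}}$ is the manifold with coordinates $(x^\mu,A_\mu,\mathfrak e,\pi^{A_\mu\nu})$, $1\le\mu,\nu\le n$, where $(x^\mu,A_\mu)$ are the coordinates on $T^*\mathcal X$, and $A=A_\mu dx^\mu$. It carries the closed $(n+1)$-form $$\Omega^{\mathrm{DDW}}=d\mathfrak e\wedge d\mathfrak y+d\pi^{A_\mu\nu}\wedge dA_\mu\wedge d\mathfrak y_\nu .$$ $\mathcal M_{\mathrm{Maxwell}}\subset\mathcal M_{\mathrm{DDW}}$ is the submanifold defined by $\pi^{A_\mu\nu}+\pi^{A_\nu\mu}=0$, equipped with the restriction of $\Omega^{\mathrm{DDW}}$ (still denoted $\Omega^{\mathrm{DDW}}$). An $(n-1)$-form $\varphi$ on a multisymplectic manifold $(\mathcal M,\Omega)$ is an algebraic observable if there is a vector field $\Xi_\varphi$ on $\mathcal M$ with $\Xi_\varphi\lrcorner\,\Omega+d\varphi=0$. The Poisson bracket of two algebraic observable $(n-1)$-forms is $$\{\varphi,\rho\}=\Xi_\varphi\lrcorner\, d\rho=-\Xi_\rho\lrcorner\,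 d\varphi .$$ *)

theory Defs
  imports "HOL-Analysis.Analysis" "HOL-Library.Function_Algebras"
begin

section \<open>Calculus on a linear subspace\<close>

text \<open>
  All manifolds here carry global linear coordinates, so a manifold is a linear subspace
  \<open>M\<close> of a Euclidean space, and each of its tangent spaces is identified with \<open>M\<close> itself.
  Only the values at points of \<open>M\<close> and on vectors of \<open>M\<close> are meaningful; restricting a form
  to a submanifold is therefore just a matter of reading the same function on a smaller \<open>M\<close>.
\<close>

definition dir_deriv :: "'a::real_normed_vector \<Rightarrow> ('a \<Rightarrow> 'b::real_normed_vector) \<Rightarrow> 'a \<Rightarrow> 'b"
  where "dir_deriv v f x = vector_derivative (\<lambda>t. f (x + t *\<^sub>R v)) (at 0)"

text \<open>\<open>k\<close>-fold differentiability along a linear subspace \<open>M\<close>.\<close>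

primrec times_differentiable_on ::
    "nat \<Rightarrow> 'a::euclidean_space set \<Rightarrow> ('a \<Rightarrow> 'b::real_normed_vector) \<Rightarrow> bool" where
  "times_differentiable_on 0 M f \<longleftrightarrow> continuous_on M f"
| "times_differentiable_on (Suc k) M f \<longleftrightarrow>
     (\<forall>x\<in>M. f differentiable (at x within M)) \<and>
     (\<forall>v\<in>M. times_differentiable_on k M (dir_deriv v f))"

definition smooth_on :: "'a::euclidean_space set \<Rightarrow> ('a \<Rightarrow> 'b::real_normed_vector) \<Rightarrow> bool"
  where "smooth_on M f \<longleftrightarrow> (\<forall>k. times_differentiable_on k M f)"


section \<open>Differential forms\<close>

text \<open>
  A \<open>k\<close>-form maps a point and a list of \<open>k\<close> tangent vectors to a real; it is \<open>0\<close> on lists of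
  any other length, so degrees need not be passed to the operations below.
\<close>

type_synonym 'a form = "'a \<Rightarrow> 'a list \<Rightarrow> real"

definition smooth_form :: "'a::euclidean_space set \<Rightarrow> nat \<Rightarrow> 'a form \<Rightarrow> bool" where
  "smooth_form M k \<omega> \<longleftrightarrow>
     (\<forall>x\<in>M. \<forall>vs\<in>lists M. length vs \<noteq> k \<longrightarrow> \<omega> x vs = 0) \<and>
     (\<forall>x\<in>M. \<forall>us\<in>lists M. \<forall>ws\<in>lists M. \<forall>v\<in>M. \<forall>w\<in>M. \<forall>a b.
        \<omega> x (us @ (a *\<^sub>R v + b *\<^sub>R w) # ws) = a * \<omega> x (us @ v # ws) + b * \<omega> x (us @ w # ws)) \<and>
     (\<forall>x\<in>M. \<forall>us\<in>lists M. \<forall>vs\<in>lists M. \<forall>ws\<in>lists M. \<forall>v\<in>M.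
        \<omega> x (us @ v # vs @ v # ws) = 0) \<and>
     (\<forall>vs\<in>lists M. smooth_on M (\<lambda>x. \<omega> x vs))"

definition form_eq_on :: "'a set \<Rightarrow> 'a form \<Rightarrow> 'a form \<Rightarrow> bool" where
  "form_eq_on M \<omega> \<eta> \<longleftrightarrow> (\<forall>x\<in>M. \<forall>vs\<in>lists M. \<omega> x vs = \<eta> x vs)"

definition fun_form :: "('a \<Rightarrow> real) \<Rightarrow> 'a form" where
  "fun_form f = (\<lambda>x vs. if vs = [] then f x else 0)"

definition scale_form :: "('a \<Rightarrow> real) \<Rightarrow> 'a form \<Rightarrow> 'a form" (infixr "*\<^sub>F" 76) where
  "f *\<^sub>F \<omega> = (\<lambda>x vs. f x * \<omega> x vs)"

text \<open>
  \<open>shuffle_sign n I\<close> is the sign of the permutation of \<open>0, \<dots>, n - 1\<close> that lists \<open>I\<close>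
  increasingly and then its complement increasingly. The wedge product sums over all such
  shuffles, i.e. it is normalised such that, for 1-forms,
  \<open>(\<alpha> \<and> \<beta>)(v, w) = \<alpha>(v) \<beta>(w) - \<alpha>(w) \<beta>(v)\<close>.
\<close>

definition shuffle_sign :: "nat \<Rightarrow> nat set \<Rightarrow> real" where
  "shuffle_sign n I = (- 1) ^ card {(i, j). i \<in> I \<and> j \<in> {..<n} - I \<and> j < i}"

definition wedge :: "'a form \<Rightarrow> 'a form \<Rightarrow> 'a form" (infixr "\<and>\<^sub>F" 75) where
  "\<alpha> \<and>\<^sub>F \<beta> = (\<lambda>x vs. \<Sum>I\<in>Pow {..<length vs}.
      shuffle_sign (length vs) I * \<alpha> x (nths vs I) * \<beta> x (nths vs (- I)))"

definition interior_prod :: "('a \<Rightarrow> 'a) \<Rightarrow> 'a form \<Rightarrow> 'a form" where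
  "interior_prod X \<omega> = (\<lambda>x vs. \<omega> x (X x # vs))"

text \<open>
  The invariant formula for the exterior derivative, evaluated on constant vector fields (whose
  Lie brackets vanish).
\<close>

definition ext_deriv :: "'a::real_normed_vector form \<Rightarrow> 'a form" where
  "ext_deriv \<omega> = (\<lambda>x vs. \<Sum>i<length vs.
      (- 1) ^ i * dir_deriv (vs ! i) (\<lambda>y. \<omega> y (nths vs (- {i}))) x)"


section \<open>Algebraic observables and Poisson bracket\<close>

definition hamiltonian_field ::
    "'a::euclidean_space set \<Rightarrow> 'a form \<Rightarrow> 'a form \<Rightarrow> ('a \<Rightarrow> 'a) \<Rightarrow> bool" where
  "hamiltonian_field M \<Omega> \<phi> \<Xi> \<longleftrightarrow>
     smooth_on M \<Xi> \<and> (\<forall>x\<in>M. \<Xi> x \<in> M) \<and>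
     form_eq_on M (interior_prod \<Xi> \<Omega> + ext_deriv \<phi>) 0"

text \<open>Here \<open>\<Omega>\<close> is an \<open>(n + 1)\<close>-form and \<open>\<phi>\<close> an \<open>(n - 1)\<close>-form.\<close>

definition algebraic_observable ::
    "nat \<Rightarrow> 'a::euclidean_space set \<Rightarrow> 'a form \<Rightarrow> 'a form \<Rightarrow> bool" where
  "algebraic_observable n M \<Omega> \<phi> \<longleftrightarrow>
     smooth_form M (n - 1) \<phi> \<and> (\<exists>\<Xi>. hamiltonian_field M \<Omega> \<phi> \<Xi>)"

definition poisson_bracket ::
    "'a::euclidean_space set \<Rightarrow> 'a form \<Rightarrow> 'a form \<Rightarrow> 'a form \<Rightarrow> 'a form" where
  "poisson_bracket M \<Omega> \<phi> \<rho> = interior_prod (SOME \<Xi>. hamiltonian_field M \<Omega> \<phi> \<Xi>) (ext_deriv \<rho>)"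

lemma hamiltonian_contractions_skew:
  assumes alt: "smooth_form M k \<Omega>" and M: "subspace M"
    and X: "hamiltonian_field M \<Omega> \<phi> X" and Y: "hamiltonian_field M \<Omega> \<rho> Y"
  shows "form_eq_on M (interior_prod X (ext_deriv \<rho>)) (- interior_prod Y (ext_deriv \<phi>))"
  unfolding form_eq_on_def
proof (intro ballI)
  fix x vs assume x: "x \<in> M" and vs: "vs \<in> lists M"
  have XY: "X x \<in> M" "Y x \<in> M" using X Y x by (auto simp: hamiltonian_field_def)
  have eX: "\<Omega> x (X x # us) = - ext_deriv \<phi> x us" if "us \<in> lists M" for us
    using X x that by (auto simp: hamiltonian_field_def form_eq_on_def interior_prod_def
        add_eq_0_iff2)
  have eY: "\<Omega> x (Y x # us) = - ext_deriv \<rho> x us" if "us \<in> lists M" for us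
    using Y x that by (auto simp: hamiltonian_field_def form_eq_on_def interior_prod_def
        add_eq_0_iff2)
  have dist: "\<Omega> x (us @ (v + w) # ws) = \<Omega> x (us @ v # ws) + \<Omega> x (us @ w # ws)"
    if "us \<in> lists M" "ws \<in> lists M" "v \<in> M" "w \<in> M" for us ws v w
  proof -
    have "\<forall>a b. \<Omega> x (us @ (a *\<^sub>R v + b *\<^sub>R w) # ws) = a * \<Omega> x (us @ v # ws) + b * \<Omega> x (us @ w # ws)"
      using alt x that unfolding smooth_form_def by blast
    from this[rule_format, of 1 1] show ?thesis by simp
  qed
  have alt0: "\<Omega> x ([] @ v # [] @ v # vs) = 0" if "v \<in> M" for v
    using alt x that vs unfolding smooth_form_def by blast
  let ?s = "X x + Y x"
  have s: "?s \<in> M" using XY M by (simp add: subspace_add)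
  have "0 = \<Omega> x (?s # ?s # vs)" using alt0[OF s] by simp
  also have "\<dots> = \<Omega> x (X x # ?s # vs) + \<Omega> x (Y x # ?s # vs)"
    using dist[of "[]" "?s # vs" "X x" "Y x"] XY s vs by simp
  also have "\<dots> = \<Omega> x (X x # Y x # vs) + \<Omega> x (Y x # X x # vs)"
    using dist[of "[X x]" vs "X x" "Y x"] dist[of "[Y x]" vs "X x" "Y x"] XY vs
      alt0[OF XY(1)] alt0[OF XY(2)] by simp
  finally have "\<Omega> x (X x # Y x # vs) = - \<Omega> x (Y x # X x # vs)" by simp
  then show "interior_prod X (ext_deriv \<rho>) x vs = (- interior_prod Y (ext_deriv \<phi>)) x vs"
    using eX[of "Y x # vs"] eY[of "X x # vs"] XY vs
    by (simp add: interior_prod_def)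
qed

text \<open>The bracket depends on no choice of Hamiltonian fields.\<close>

lemma poisson_bracket_eq:
  assumes "smooth_form M k \<Omega>" "subspace M"
    and X: "hamiltonian_field M \<Omega> \<phi> X" and Y: "hamiltonian_field M \<Omega> \<rho> Y"
  shows "form_eq_on M (poisson_bracket M \<Omega> \<phi> \<rho>) (interior_prod X (ext_deriv \<rho>))"
    and "form_eq_on M (poisson_bracket M \<Omega> \<phi> \<rho>) (- interior_prod Y (ext_deriv \<phi>))"
proof -
  have Z: "hamiltonian_field M \<Omega> \<phi> (SOME \<Xi>. hamiltonian_field M \<Omega> \<phi> \<Xi>)"
    using X by (rule someI[where P = "hamiltonian_field M \<Omega> \<phi>"])
  show 2: "form_eq_on M (poisson_bracket M \<Omega> \<phi> \<rho>) (- interior_prod Y (ext_deriv \<phi>))"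
    unfolding poisson_bracket_def
    by (rule hamiltonian_contractions_skew[OF assms(1,2) Z Y])
  show "form_eq_on M (poisson_bracket M \<Omega> \<phi> \<rho>) (interior_prod X (ext_deriv \<rho>))"
    using 2 hamiltonian_contractions_skew[OF assms(1,2) X Y]
    by (simp add: form_eq_on_def)
qed


section \<open>The De Donder-Weyl and Maxwell manifolds\<close>

text \<open>The coordinates \<open>(x\<^sup>\<mu>, A\<^sub>\<mu>, e, \<pi>)\<close>; the entry of \<open>\<pi>\<close> in row \<open>\<mu>\<close>, column \<open>\<nu>\<close> belongs to
  \<open>A\<^sub>\<mu>\<close> and \<open>x\<^sup>\<nu>\<close>.\<close>

type_synonym spacetime = "real^4"
type_synonym ddw = "(real^4) \<times> (real^4) \<times> real \<times> (real^4^4)"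

definition x_of :: "ddw \<Rightarrow> spacetime" where "x_of = (\<lambda>(x, A, e, p). x)"
definition A_coord :: "4 \<Rightarrow> ddw \<Rightarrow> real" where "A_coord \<mu> = (\<lambda>(x, A, e, p). A $ \<mu>)"
definition e_coord :: "ddw \<Rightarrow> real" where "e_coord = (\<lambda>(x, A, e, p). e)"
definition pi_coord :: "4 \<Rightarrow> 4 \<Rightarrow> ddw \<Rightarrow> real" where
  "pi_coord \<mu> \<nu> = (\<lambda>(x, A, e, p). p $ \<mu> $ \<nu>)"

definition dx :: "4 \<Rightarrow> ddw form" where "dx \<mu> = ext_deriv (fun_form (\<lambda>m. x_of m $ \<mu>))"
definition dA :: "4 \<Rightarrow> ddw form" where "dA \<mu> = ext_deriv (fun_form (A_coord \<mu>))"
definition de :: "ddw form" where "de = ext_deriv (fun_form e_coord)"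
definition dpi :: "4 \<Rightarrow> 4 \<Rightarrow> ddw form" where "dpi \<mu> \<nu> = ext_deriv (fun_form (pi_coord \<mu> \<nu>))"

definition partial_x :: "4 \<Rightarrow> ddw \<Rightarrow> ddw" where "partial_x \<mu> = (\<lambda>_. (axis \<mu> 1, 0, 0, 0))"

text \<open>In the index type \<open>4\<close> the numeral \<open>4\<close> equals \<open>0\<close>, so \<open>1, 2, 3, 4\<close> are its four elements.\<close>

definition dy :: "ddw form" where "dy = dx 1 \<and>\<^sub>F dx 2 \<and>\<^sub>F dx 3 \<and>\<^sub>F dx 4"
definition dy1 :: "4 \<Rightarrow> ddw form" where "dy1 \<nu> = interior_prod (partial_x \<nu>) dy"
definition dy2 :: "4 \<Rightarrow> 4 \<Rightarrow> ddw form" where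
  "dy2 \<mu> \<nu> = interior_prod (partial_x \<mu>) (interior_prod (partial_x \<nu>) dy)"

definition A_form :: "ddw form" where "A_form = (\<Sum>\<mu>\<in>UNIV. A_coord \<mu> *\<^sub>F dx \<mu>)"

definition Omega_DDW :: "ddw form" where
  "Omega_DDW = de \<and>\<^sub>F dy + (\<Sum>\<mu>\<in>UNIV. \<Sum>\<nu>\<in>UNIV. dpi \<mu> \<nu> \<and>\<^sub>F dA \<mu> \<and>\<^sub>F dy1 \<nu>)"

definition M_Maxwell :: "ddw set" where
  "M_Maxwell = {m. \<forall>\<mu> \<nu>. pi_coord \<mu> \<nu> m + pi_coord \<nu> \<mu> m = 0}"

definition P_form :: "(4 \<Rightarrow> spacetime \<Rightarrow> real) \<Rightarrow> ddw form" where
  "P_form \<phi> = (\<Sum>\<mu>\<in>UNIV. \<Sum>\<nu>\<in>UNIV. (\<lambda>m. \<phi> \<mu> (x_of m) * pi_coord \<mu> \<nu> m) *\<^sub>F dy1 \<nu>)"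

definition Q_form :: "(4 \<Rightarrow> 4 \<Rightarrow> spacetime \<Rightarrow> real) \<Rightarrow> ddw form" where
  "Q_form \<psi> = (\<Sum>\<mu>\<in>UNIV. \<Sum>\<nu>\<in>UNIV. (\<lambda>m. 1 / 2 * \<psi> \<mu> \<nu> (x_of m)) *\<^sub>F (A_form \<and>\<^sub>F dy2 \<mu> \<nu>))"

end

theory Submission
  imports Defs
begin

text \<open>
  By the skew symmetry of \<open>\<psi>\<close> and \<open>dx\<^sup>\<rho> \<and> dy\<^sub>\<mu>\<^sub>\<nu> = \<delta>\<^sup>\<rho>\<^sub>\<mu> dy\<^sub>\<nu> - \<delta>\<^sup>\<rho>\<^sub>\<nu> dy\<^sub>\<mu>\<close>, the observable
  \<open>Q\<^sup>\<psi>\<close> equals \<open>\<psi>\<^sup>\<mu>\<^sup>\<nu> A\<^sub>\<mu> dy\<^sub>\<nu>\<close>. Hence \<open>P\<close> and \<open>Q\<close> both have the shape \<open>f\<^sup>\<mu>\<^sup>\<nu>(x) L\<^sub>\<mu>\<^sub>\<nu> dy\<^sub>\<nu>\<close> with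
  \<open>L\<^sub>\<mu>\<^sub>\<nu>\<close> linear in the fibre coordinates, and \<open>dx\<^sup>\<kappa> \<and> dy\<^sub>\<nu> = \<delta>\<^sup>\<kappa>\<^sub>\<nu> dy\<close> gives their differential
  \<open>L\<^sub>\<mu>\<^sub>\<nu> \<partial>\<^sub>\<nu>f\<^sup>\<mu>\<^sup>\<nu> dy + f\<^sup>\<mu>\<^sup>\<nu> dL\<^sub>\<mu>\<^sub>\<nu> \<and> dy\<^sub>\<nu>\<close>. Comparing with the contraction of \<open>\<Omega>\<close> with a field
  without \<open>x\<close>-component, Hamiltonian fields are
  \<open>\<phi>\<^sub>\<mu> \<partial>/\<partial>A\<^sub>\<mu> - \<pi>\<^sup>\<mu>\<^sup>\<nu> \<partial>\<^sub>\<nu>\<phi>\<^sub>\<mu> \<partial>/\<partial>e\<close> for \<open>P\<^sub>\<phi>\<close> and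
  \<open>- \<psi>\<^sup>\<mu>\<^sup>\<nu> \<partial>/\<partial>\<pi>\<^sup>\<mu>\<^sup>\<nu> - A\<^sub>\<mu> \<partial>\<^sub>\<nu>\<psi>\<^sup>\<mu>\<^sup>\<nu> \<partial>/\<partial>e\<close> for \<open>Q\<^sup>\<psi>\<close>. The latter is tangent to the Maxwell
  submanifold because \<open>\<psi>\<close> is skew, and contracting these fields with the differentials gives
  the brackets.
\<close>

section \<open>Smooth functions\<close>

lemma dir_deriv_eq:
  assumes "(f has_derivative D) (at x)"
  shows "dir_deriv v f x = D v"
proof -
  have "((\<lambda>t::real. x + t *\<^sub>R v) has_derivative (\<lambda>t. t *\<^sub>R v)) (at 0)"
    by (auto intro!: derivative_eq_intros)
  moreover have "(f has_derivative D) (at (x + 0 *\<^sub>R v))"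
    using assms by simp
  ultimately have "((\<lambda>t. f (x + t *\<^sub>R v)) has_derivative (\<lambda>t. D (t *\<^sub>R v))) (at 0)"
    by (rule has_derivative_compose)
  moreover have "(\<lambda>t. D (t *\<^sub>R v)) = (\<lambda>t. t *\<^sub>R D v)"
    using has_derivative_linear[OF assms] by (simp add: linear_cmul)
  ultimately have "((\<lambda>t. f (x + t *\<^sub>R v)) has_vector_derivative D v) (at 0)"
    by (simp add: has_vector_derivative_def)
  then show ?thesis
    by (simp add: dir_deriv_def vector_derivative_at)
qed

lemma dir_deriv_frechet:
  "f differentiable at x \<Longrightarrow> dir_deriv v f x = frechet_derivative f (at x) v"
  by (simp add: dir_deriv_eq frechet_derivative_works[symmetric])

lemma linear_dir_deriv:
  "f differentiable at x \<Longrightarrow> linear (\<lambda>v. dir_deriv v f x)"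
  by (simp add: dir_deriv_frechet linear_frechet_derivative)

lemma dir_deriv_const [simp]: "dir_deriv v (\<lambda>x. c) x = 0"
  by (simp add: dir_deriv_eq[OF has_derivative_const])

lemma dir_deriv_linear:
  "bounded_linear L \<Longrightarrow> dir_deriv v L x = L v"
  by (rule dir_deriv_eq) (rule bounded_linear_imp_has_derivative)

text \<open>A linear map carries the line through \<open>x\<close> along \<open>v\<close> to the
  line through \<open>L x\<close> along \<open>L v\<close>, so both sides differentiate the same
  curve.\<close>

lemma dir_deriv_compose_linear:
  assumes "linear L"
  shows "dir_deriv v (\<lambda>x. f (L x)) x = dir_deriv (L v) f (L x)"
  using assms by (simp add: dir_deriv_def linear_add linear_cmul)

lemma dir_deriv_sum:
  assumes "\<And>i. i \<in> I \<Longrightarrow> f i differentiable at x"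
  shows "dir_deriv v (\<lambda>x. \<Sum>i\<in>I. f i x) x = (\<Sum>i\<in>I. dir_deriv v (f i) x)"
proof -
  have "((\<lambda>x. \<Sum>i\<in>I. f i x) has_derivative (\<lambda>v. \<Sum>i\<in>I. frechet_derivative (f i) (at x) v)) (at x)"
    using assms by (intro has_derivative_sum) (simp add: frechet_derivative_works[symmetric])
  then show ?thesis
    using assms by (simp add: dir_deriv_eq dir_deriv_frechet)
qed

lemma dir_deriv_add:
  assumes "f differentiable at x" "g differentiable at x"
  shows "dir_deriv v (\<lambda>x. f x + g x) x = dir_deriv v f x + dir_deriv v g x"
  using dir_deriv_eq[OF has_derivative_add[OF assms[unfolded frechet_derivative_works]]] assms
  by (simp add: dir_deriv_frechet)

lemma dir_deriv_scaleR:
  assumes "f differentiable at x" "g differentiable at x"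
  shows "dir_deriv v (\<lambda>x. f x *\<^sub>R g x) x = f x *\<^sub>R dir_deriv v g x + dir_deriv v f x *\<^sub>R g x"
  using dir_deriv_eq[OF has_derivative_scaleR[OF assms[unfolded frechet_derivative_works]]] assms
  by (simp add: dir_deriv_frechet)

lemma dir_deriv_mult:
  fixes f g :: "'a::real_normed_vector \<Rightarrow> real"
  assumes "f differentiable at x" "g differentiable at x"
  shows "dir_deriv v (\<lambda>x. f x * g x) x = f x * dir_deriv v g x + dir_deriv v f x * g x"
  using dir_deriv_scaleR[OF assms] by simp

text \<open>Serves to write the differential of a coefficient on spacetime through its partial
  derivatives and the \<open>dx\<close>.\<close>

lemma dir_deriv_axis:
  fixes f :: "real ^ 'n \<Rightarrow> real"
  assumes "f differentiable at x"
  shows "dir_deriv v f x = (\<Sum>i\<in>UNIV. v $ i * dir_deriv (axis i 1) f x)"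
proof -
  have "v = (\<Sum>i\<in>UNIV. (v $ i) *\<^sub>R axis i 1)"
    using basis_expansion[of v] by (simp add: scalar_mult_eq_scaleR)
  then have "dir_deriv v f x = dir_deriv (\<Sum>i\<in>UNIV. (v $ i) *\<^sub>R axis i 1) f x"
    by simp
  also have "\<dots> = (\<Sum>i\<in>UNIV. v $ i * dir_deriv (axis i 1) f x)"
    using linear_sum[OF linear_dir_deriv[OF assms], of "\<lambda>i. (v $ i) *\<^sub>R axis i 1" UNIV]
      linear_dir_deriv[OF assms] by (simp add: linear_iff)
  finally show ?thesis .
qed

section \<open>Iterated differentiability and its closure properties\<close>

lemma times_differentiable_on_subset:
  assumes "times_differentiable_on k M f" "N \<subseteq> M"
  shows "times_differentiable_on k N f"
  using assms
proof (induction k arbitrary: f)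
  case 0
  then show ?case by (auto intro: continuous_on_subset)
next
  case (Suc k)
  then show ?case
    by (auto intro: differentiable_within_subset)
qed

text \<open>Needed for the product rule, whose terms pair an undifferentiated factor with a
  derivative of one order less.\<close>

lemma times_differentiable_on_SucD:
  "times_differentiable_on (Suc k) M f \<Longrightarrow> times_differentiable_on k M f"
proof (induction k arbitrary: f)
  case 0
  then show ?case
    by (auto simp: continuous_on_eq_continuous_within differentiable_imp_continuous_within)
next
  case (Suc k)
  from Suc.prems have "f differentiable (at x within M)"
    and "times_differentiable_on (Suc k) M (dir_deriv x f)" if "x \<in> M" for x
    using that times_differentiable_on.simps(2)[of "Suc k" M f] by simp_all
  then show ?case
    using Suc.IH times_differentiable_on.simps(2)[of k M f] by simp
qed

lemma times_differentiable_on_const: "times_differentiable_on k UNIV (\<lambda>x. c)"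
proof (induction k arbitrary: c)
  case (Suc k)
  have "dir_deriv v (\<lambda>x. c) = (\<lambda>x. 0)" for v :: 'a
    by (simp add: fun_eq_iff)
  then show ?case
    using Suc by simp
qed simp

lemma times_differentiable_on_add:
  assumes "times_differentiable_on k UNIV f" "times_differentiable_on k UNIV g"
  shows "times_differentiable_on k UNIV (\<lambda>x. f x + g x)"
  using assms
proof (induction k arbitrary: f g)
  case 0
  then show ?case by (auto intro: continuous_on_add)
next
  case (Suc k)
  then have "dir_deriv v (\<lambda>x. f x + g x) = (\<lambda>x. dir_deriv v f x + dir_deriv v g x)" for v
    by (auto simp: fun_eq_iff intro!: dir_deriv_add)
  then show ?case
    using Suc by simp
qed

lemma times_differentiable_on_scaleR:
  assumes "times_differentiable_on k UNIV f" "times_differentiable_on k UNIV g"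
  shows "times_differentiable_on k UNIV (\<lambda>x. f x *\<^sub>R g x)"
  using assms
proof (induction k arbitrary: f g)
  case 0
  then show ?case by (auto intro: continuous_on_scaleR)
next
  case (Suc k)
  then have "dir_deriv v (\<lambda>x. f x *\<^sub>R g x)
      = (\<lambda>x. f x *\<^sub>R dir_deriv v g x + dir_deriv v f x *\<^sub>R g x)" for v
    by (auto simp: fun_eq_iff intro!: dir_deriv_scaleR)
  then show ?case
    using Suc Suc.prems[THEN times_differentiable_on_SucD]
    by (simp add: times_differentiable_on_add)
qed

lemma times_differentiable_on_compose_linear:
  assumes "linear L" "times_differentiable_on k UNIV f"
  shows "times_differentiable_on k UNIV (\<lambda>x. f (L x))"
  using assms(2)
proof (induction k arbitrary: f)
  case 0
  have "continuous_on UNIV L"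
    using assms(1) by (simp add: linear_continuous_on linear_conv_bounded_linear)
  then show ?case
    using 0 continuous_on_compose2[of UNIV f UNIV L] by simp
next
  case (Suc k)
  have "(\<lambda>x. f (L x)) differentiable at x" for x
    using Suc.prems linear_imp_differentiable[OF assms(1)]
    by (intro differentiable_compose[of f L]) simp_all
  moreover have "dir_deriv v (\<lambda>x. f (L x)) = (\<lambda>x. dir_deriv (L v) f (L x))" for v
    using assms(1) by (simp add: fun_eq_iff dir_deriv_compose_linear)
  ultimately show ?case
    using Suc by simp
qed

text \<open>A smaller set tests fewer points and directions, and \<open>dir_deriv\<close> does not
  refer to the set. Smoothness on the ambient space, where the calculus rules are proved, thus
  passes to the Maxwell subspace.\<close>

lemma smooth_on_subset: "smooth_on M f \<Longrightarrow> N \<subseteq> M \<Longrightarrow> smooth_on N f"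
  unfolding smooth_on_def using times_differentiable_on_subset by blast

lemma smooth_on_differentiable: "smooth_on UNIV f \<Longrightarrow> f differentiable at x"
  using times_differentiable_on.simps(2)[of 0 UNIV f] unfolding smooth_on_def by simp

lemma smooth_on_dir_deriv: "smooth_on UNIV f \<Longrightarrow> smooth_on UNIV (dir_deriv v f)"
  using times_differentiable_on.simps(2)[of _ UNIV f] unfolding smooth_on_def by simp

lemma smooth_on_const: "smooth_on UNIV (\<lambda>x. c)"
  by (simp add: smooth_on_def times_differentiable_on_const)

lemma smooth_on_add:
  "smooth_on UNIV f \<Longrightarrow> smooth_on UNIV g \<Longrightarrow> smooth_on UNIV (\<lambda>x. f x + g x)"
  by (simp add: smooth_on_def times_differentiable_on_add)

lemma smooth_on_scaleR:
  "smooth_on UNIV f \<Longrightarrow> smooth_on UNIV g \<Longrightarrow> smooth_on UNIV (\<lambda>x. f x *\<^sub>R g x)"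
  by (simp add: smooth_on_def times_differentiable_on_scaleR)

lemma smooth_on_mult:
  fixes f g :: "'a::euclidean_space \<Rightarrow> real"
  shows "smooth_on UNIV f \<Longrightarrow> smooth_on UNIV g \<Longrightarrow> smooth_on UNIV (\<lambda>x. f x * g x)"
  using smooth_on_scaleR[of f g] by simp

lemma smooth_on_minus:
  "smooth_on UNIV f \<Longrightarrow> smooth_on UNIV (\<lambda>x. - f x)"
  using smooth_on_scaleR[OF smooth_on_const[of "- 1"], of f] by simp

lemma smooth_on_sum:
  "(\<And>i. i \<in> I \<Longrightarrow> smooth_on UNIV (f i)) \<Longrightarrow> smooth_on UNIV (\<lambda>x. \<Sum>i\<in>I. f i x)"
  by (induction I rule: infinite_finite_induct) (auto intro: smooth_on_const smooth_on_add)

lemma smooth_on_compose_linear: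
  "linear L \<Longrightarrow> smooth_on UNIV f \<Longrightarrow> smooth_on UNIV (\<lambda>x. f (L x))"
  by (simp add: smooth_on_def times_differentiable_on_compose_linear)

lemma smooth_on_linear:
  assumes "linear L"
  shows "smooth_on UNIV L"
proof -
  \<comment> \<open>The derivative is constant, so a case split on \<open>k\<close> suffices
    afterwards.\<close>
  have "dir_deriv v L = (\<lambda>x. L v)" for v
    using assms by (simp add: fun_eq_iff dir_deriv_linear linear_conv_bounded_linear)
  then have "times_differentiable_on k UNIV L" for k
    using assms
    by (cases k) (auto simp: times_differentiable_on_const linear_imp_differentiable
        linear_continuous_on linear_conv_bounded_linear)
  then show ?thesis
    by (simp add: smooth_on_def)
qed

text \<open>Meant for the Hamiltonian fields, whose coordinates are scalar expressions covered by
  the rules above.\<close>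

lemma smooth_on_componentwise:
  fixes f :: "'a::euclidean_space \<Rightarrow> 'b::euclidean_space"
  assumes "\<And>b. b \<in> Basis \<Longrightarrow> smooth_on UNIV (\<lambda>x. f x \<bullet> b)"
  shows "smooth_on UNIV f"
proof -
  have "smooth_on UNIV (\<lambda>x. \<Sum>b\<in>Basis. (f x \<bullet> b) *\<^sub>R b)"
    using assms by (intro smooth_on_sum smooth_on_scaleR smooth_on_const)
  then show ?thesis
    by (simp add: euclidean_representation)
qed

section \<open>Alternating forms on a vector space\<close>

text \<open>
  Defined by recursion on the degree through contractions, so that only repetitions in the
  first two slots have to be excluded.
\<close>

primrec alternating :: "nat \<Rightarrow> ('a::real_vector list \<Rightarrow> real) \<Rightarrow> bool" where
  "alternating 0 w \<longleftrightarrow> (\<forall>v vs. w (v # vs) = 0)"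
| "alternating (Suc k) w \<longleftrightarrow> w [] = 0 \<and> (\<forall>v. alternating k (\<lambda>vs. w (v # vs))) \<and>
     (\<forall>vs. linear (\<lambda>v. w (v # vs))) \<and> (\<forall>v vs. w (v # v # vs) = 0)"

lemma alternating_contract:
  "alternating k w \<Longrightarrow> alternating (k - 1) (\<lambda>vs. w (v # vs))"
  by (cases k) auto

lemma alternating_length: "alternating k w \<Longrightarrow> length vs \<noteq> k \<Longrightarrow> w vs = 0"
proof (induction k arbitrary: w vs)
  case 0
  then show ?case by (cases vs) auto
next
  case (Suc k)
  then show ?case
    using Suc.IH[of "\<lambda>us. w (hd vs # us)" "tl vs"] by (cases vs) auto
qed

text \<open>Contracting with the vectors before the slot brings it to the front, where the
  definition grants linearity.\<close>

lemma linear_alternating: "alternating k w \<Longrightarrow> linear (\<lambda>v. w (us @ v # ws))"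
proof (induction us arbitrary: k w)
  case Nil
  then show ?case
    by (cases k) (auto simp: linear_zero)
next
  case (Cons u us)
  then show ?case
    using Cons.IH[OF alternating_contract[OF Cons.prems]] by simp
qed

text \<open>Polarization: expand the vanishing value on a repeated \<open>u + v\<close>.\<close>

lemma alternating_swap:
  assumes "alternating k w"
  shows "w (u # v # vs) = - w (v # u # vs)"
proof -
  have z: "w (x # x # vs) = 0" for x
    using assms by (cases k) auto
  have 1: "w ((x + y) # us) = w (x # us) + w (y # us)" for x y us
    using linear_alternating[OF assms, of "[]"] by (simp add: linear_iff)
  have 2: "w (a # (x + y) # us) = w (a # x # us) + w (a # y # us)" for a x y us
    using linear_alternating[OF assms, of "[a]"] by (simp add: linear_iff)
  show ?thesis
    using z[of "u + v"] z[of u] z[of v] by (simp add: 1 2)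
qed

text \<open>Contraction removes the prefix; then each vector between the two copies is swapped to
  the front and contracted away.\<close>

lemma alternating_repeat: "alternating k w \<Longrightarrow> w (us @ v # vs @ v # ws) = 0"
proof (induction us arbitrary: k w)
  case Nil
  then show ?case
  proof (induction vs arbitrary: k w)
    case Nil
    then show ?case by (cases k) auto
  next
    case (Cons u vs)
    have "w (u # v # vs @ v # ws) = 0"
      using Cons.IH[OF alternating_contract[OF Cons.prems]] by simp
    then show ?case
      using alternating_swap[OF Cons.prems, of v u] by simp
  qed
next
  case (Cons u us)
  then show ?case
    using Cons.IH[OF alternating_contract[OF Cons.prems]] by simp
qed

lemma alternating_zero: "alternating k (\<lambda>vs. 0)"
  by (induction k) (auto simp: linear_zero)

lemma alternating_add:
  "alternating k w \<Longrightarrow> alternating k w' \<Longrightarrow> alternating k (\<lambda>vs. w vs + w' vs)"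
  by (induction k arbitrary: w w') (auto simp: linear_iff algebra_simps)

lemma alternating_scale:
  "alternating k w \<Longrightarrow> alternating k (\<lambda>vs. c * w vs)"
  by (induction k arbitrary: w) (auto simp: linear_iff algebra_simps)

lemma alternating_sum:
  "(\<And>i. i \<in> I \<Longrightarrow> alternating k (w i)) \<Longrightarrow> alternating k (\<lambda>vs. \<Sum>i\<in>I. w i vs)"
  by (induction I rule: infinite_finite_induct) (auto intro: alternating_zero alternating_add)

text \<open>
  The wedge product of a covector with a form. The recursion is the antiderivation rule
  \<open>\<iota>\<^sub>v(a \<and> w) = a(v) w - a \<and> \<iota>\<^sub>v w\<close>, so identities between such products follow by contracting
  with one vector at a time.
\<close>

fun cov_wedge :: "('a \<Rightarrow> real) \<Rightarrow> ('a list \<Rightarrow> real) \<Rightarrow> 'a list \<Rightarrow> real" where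
  "cov_wedge a w [] = 0"
| "cov_wedge a w (v # vs) = a v * w vs - cov_wedge a (\<lambda>us. w (v # us)) vs"

lemma cov_wedge_zero_left [simp]: "cov_wedge (\<lambda>v. 0) w vs = 0"
  by (induction vs arbitrary: w) auto

lemma cov_wedge_zero_right [simp]: "cov_wedge a (\<lambda>vs. 0) vs = 0"
  by (induction vs) auto

lemma cov_wedge_add_left:
  "cov_wedge (\<lambda>v. a v + b v) w vs = cov_wedge a w vs + cov_wedge b w vs"
  by (induction vs arbitrary: w) (auto simp: algebra_simps)

lemma cov_wedge_scale_left: "cov_wedge (\<lambda>v. c * a v) w vs = c * cov_wedge a w vs"
  by (induction vs arbitrary: w) (auto simp: algebra_simps)

lemma cov_wedge_sum_left:
  "cov_wedge (\<lambda>v. \<Sum>i\<in>I. a i v) w vs = (\<Sum>i\<in>I. cov_wedge (a i) w vs)"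
  by (induction I rule: infinite_finite_induct) (auto simp: cov_wedge_add_left)

lemma cov_wedge_add_right:
  "cov_wedge a (\<lambda>vs. w vs + w' vs) vs = cov_wedge a w vs + cov_wedge a w' vs"
  by (induction vs arbitrary: w w') (auto simp: algebra_simps)

lemma cov_wedge_scale_right: "cov_wedge a (\<lambda>vs. c * w vs) vs = c * cov_wedge a w vs"
  by (induction vs arbitrary: w) (auto simp: algebra_simps)

lemma cov_wedge_diff_right:
  "cov_wedge a (\<lambda>vs. w vs - w' vs) vs = cov_wedge a w vs - cov_wedge a w' vs"
  by (induction vs arbitrary: w w') (auto simp: algebra_simps)

text \<open>After contraction with \<open>v\<close>, the terms with \<open>a v\<close> and
  \<open>b v\<close> are visibly antisymmetric; the remaining one is the same claim for the
  contracted \<open>w\<close>.\<close>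

lemma cov_wedge_anticommute:
  "cov_wedge a (cov_wedge b w) vs = - cov_wedge b (cov_wedge a w) vs"
proof (induction vs arbitrary: w)
  case (Cons v vs)
  show ?case
    using Cons.IH[of "\<lambda>us. w (v # us)"]
    by (simp add: cov_wedge_diff_right cov_wedge_scale_right)
qed simp

lemma cov_wedge_self [simp]: "cov_wedge a (cov_wedge a w) vs = 0"
  using cov_wedge_anticommute[of a a w vs] by simp

text \<open>Moves \<open>a\<close> past one factor; repeated, it brings a \<open>dx\<close> next to
  its own copy inside \<open>vol\<close>.\<close>

lemma cov_wedge_eq_0:
  assumes "\<And>vs. cov_wedge a w vs = 0"
  shows "cov_wedge a (cov_wedge b w) vs = 0"
proof -
  have "cov_wedge a w = (\<lambda>vs. 0)"
    using assms by blast
  then show ?thesis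
    by (simp add: cov_wedge_anticommute[of a b])
qed

lemma linear_cov_wedge_right:
  assumes "\<And>vs. linear (\<lambda>v. W v vs)"
  shows "linear (\<lambda>v. cov_wedge a (W v) vs)"
proof -
  have "W (x + y) = (\<lambda>vs. W x vs + W y vs)" "W (c *\<^sub>R x) = (\<lambda>vs. c * W x vs)" for x y c
    using assms by (auto simp: linear_iff)
  then show ?thesis
    by (simp add: linear_iff cov_wedge_add_right cov_wedge_scale_right)
qed

lemma alternating_cov_wedge:
  assumes "linear a"
  shows "alternating k w \<Longrightarrow> alternating (Suc k) (cov_wedge a w)"
proof (induction k arbitrary: w)
  case 0
  then have "w (v # vs) = 0" for v vs
    by simp
  then show ?case
    using assms by (auto simp: linear_iff algebra_simps)
next
  case (Suc k)
  \<comment> \<open>The contraction of the product, written with the factor \<open>- 1\<close> so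
    that closure under sums and multiples applies.\<close>
  have "alternating (Suc k) (\<lambda>vs. a v * w vs + - 1 * cov_wedge a (\<lambda>us. w (v # us)) vs)" for v
    using Suc by (intro alternating_add alternating_scale Suc.IH) auto
  moreover have "linear (\<lambda>v. a v * w vs - cov_wedge a (\<lambda>us. w (v # us)) vs)" for vs
    using Suc.prems linear_cov_wedge_right[of "\<lambda>v us. w (v # us)" a vs] assms
    by (simp add: linear_iff algebra_simps)
  ultimately show ?case
    using Suc.prems by simp
qed

text \<open>Links the recursion to both the shuffle sum of \<open>wedge\<close> and the alternating
  sum of \<open>ext_deriv\<close>, which reduce to this expression.\<close>

lemma cov_wedge_eq_sum:
  "cov_wedge a w vs = (\<Sum>i<length vs. (- 1) ^ i * a (vs ! i) * w (nths vs (- {i})))"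
proof (induction vs arbitrary: w)
  case (Cons v vs)
  have 0: "nths (v # vs) (- {0}) = vs"
    by (auto simp: nths_Cons intro!: nths_all)
  have S: "nths (v # vs) (- {Suc i}) = v # nths vs (- {i})" for i
    by (auto simp: nths_Cons intro!: arg_cong[of _ _ "nths vs"])
  show ?case
    by (simp add: sum.lessThan_Suc_shift Cons 0 S flip: sum_negf del: sum.lessThan_Suc)
qed simp

section \<open>Covectors and the shuffle wedge product\<close>

definition covector :: "('a \<Rightarrow> real) \<Rightarrow> 'a list \<Rightarrow> real" where
  "covector a vs = (case vs of [v] \<Rightarrow> a v | _ \<Rightarrow> 0)"

text \<open>Multiplying by the 0-form 1 lets the rules for \<open>cov_wedge\<close> reach the
  innermost factor of a product.\<close>

lemma covector_eq_cov_wedge: "covector a = cov_wedge a (\<lambda>vs. if vs = [] then 1 else 0)"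
proof
  fix vs
  show "covector a vs = cov_wedge a (\<lambda>vs. if vs = [] then 1 else 0) vs"
    by (cases vs; cases "tl vs") (auto simp: covector_def)
qed

lemma alternating_covector: "linear a \<Longrightarrow> alternating 1 (covector a)"
  by (simp only: covector_eq_cov_wedge One_nat_def) (rule alternating_cov_wedge, auto)

lemma nths_singleton_eq: "i < length vs \<Longrightarrow> nths vs {i} = [vs ! i]"
proof (induction vs arbitrary: i)
  case (Cons v vs)
  have "{j. j = i - 1 \<and> i \<noteq> 0} = (if i = 0 then {} else {i - 1})"
    by auto
  moreover have "{j. Suc j = i} = (if i = 0 then {} else {i - 1})"
    by auto
  ultimately show ?case
    using Cons by (cases i) (auto simp: nths_Cons)
qed simp

lemma shuffle_sign_singleton: "i < n \<Longrightarrow> shuffle_sign n {i} = (- 1) ^ i"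
proof -
  assume "i < n"
  then have "{(i', j). i' \<in> {i} \<and> j \<in> {..<n} - {i} \<and> j < i'} = Pair i ` {..<i}"
    by auto
  then show ?thesis
    by (simp add: shuffle_sign_def card_image inj_on_def)
qed

text \<open>A covector vanishes on lists of length other than 1, so only singleton shuffles
  contribute, with sign \<open>(- 1) ^ i\<close>.\<close>

lemma wedge_covector:
  assumes "\<alpha> x = covector a"
  shows "(\<alpha> \<and>\<^sub>F \<beta>) x = cov_wedge a (\<beta> x)"
proof
  fix vs
  let ?t = "\<lambda>I. shuffle_sign (length vs) I * \<alpha> x (nths vs I) * \<beta> x (nths vs (- I))"
  have "(\<Sum>I\<in>Pow {..<length vs}. ?t I) = (\<Sum>I\<in>(\<lambda>i. {i}) ` {..<length vs}. ?t I)"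
  proof (rule sum.mono_neutral_right)
    show "\<forall>I\<in>Pow {..<length vs} - (\<lambda>i. {i}) ` {..<length vs}. ?t I = 0"
    proof
      fix I assume I: "I \<in> Pow {..<length vs} - (\<lambda>i. {i}) ` {..<length vs}"
      \<comment> \<open>All elements of \<open>I\<close> are valid positions, so
        \<open>nths vs I\<close> has \<open>card I\<close> entries.\<close>
      then have "{i. i < length vs \<and> i \<in> I} = I"
        by auto
      moreover have "card I \<noteq> 1"
        using I by (auto simp: card_1_singleton_iff)
      ultimately have "length (nths vs I) \<noteq> 1"
        by (simp add: length_nths)
      then have "covector a (nths vs I) = 0"
        by (auto simp: covector_def split: list.splits)
      then show "?t I = 0"
        by (simp add: assms)
    qed
  qed auto
  also have "\<dots> = (\<Sum>i<length vs. ?t {i})"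
    by (subst sum.reindex) auto
  also have "\<dots> = cov_wedge a (\<beta> x) vs"
    by (auto simp: cov_wedge_eq_sum assms shuffle_sign_singleton nths_singleton_eq covector_def)
  finally show "(\<alpha> \<and>\<^sub>F \<beta>) x vs = cov_wedge a (\<beta> x) vs"
    by (simp add: wedge_def)
qed

section \<open>Combinations of constant forms\<close>

lemma sum_apply: "(\<Sum>i\<in>I. f i) x = (\<Sum>i\<in>I. f i x)"
  by (induction I rule: infinite_finite_induct) auto

lemma ext_deriv_fun_linear:
  fixes a :: "'a::euclidean_space \<Rightarrow> real"
  assumes "linear a"
  shows "ext_deriv (fun_form a) x = covector a"
proof
  fix vs :: "'a list"
  consider "vs = []" | v where "vs = [v]" | u v us where "vs = u # v # us"
    by (metis list.exhaust)
  then show "ext_deriv (fun_form a) x vs = covector a vs"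
  proof cases
    case 2
    then show ?thesis
      using assms by (simp add: ext_deriv_def fun_form_def covector_def nths_Cons dir_deriv_linear
          linear_conv_bounded_linear)
  next
    case 3
    \<comment> \<open>Deleting one of at least two vectors leaves a nonempty list, on which a 0-form
      is zero.\<close>
    have "nths vs (- {i}) \<noteq> []" if "i < length vs" for i
    proof -
      have "{j. j < length vs \<and> j \<in> - {i}} = {..<length vs} - {i}"
        by auto
      then have "length (nths vs (- {i})) = length vs - 1"
        using that by (simp add: length_nths)
      then show ?thesis
        using 3 by auto
    qed
    then have "ext_deriv (fun_form a) x vs = 0"
      by (simp add: ext_deriv_def fun_form_def)
    then show ?thesis
      using 3 by (simp add: covector_def)
  qed (simp add: ext_deriv_def covector_def)
qed

text \<open>The \<open>c i\<close> do not depend on the point, so only the coefficients are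
  differentiated.\<close>

lemma ext_deriv_combination:
  assumes "\<And>i. i \<in> I \<Longrightarrow> f i differentiable at x"
  shows "ext_deriv (\<lambda>y vs. \<Sum>i\<in>I. f i y * c i vs) x vs
    = (\<Sum>i\<in>I. cov_wedge (\<lambda>v. dir_deriv v (f i) x) (c i) vs)"
proof -
  have "dir_deriv v (\<lambda>y. \<Sum>i\<in>I. f i y * c i us) x = (\<Sum>i\<in>I. dir_deriv v (f i) x * c i us)" for v us
    using assms by (subst dir_deriv_sum) (auto simp: dir_deriv_mult intro!: sum.cong)
  then have "ext_deriv (\<lambda>y vs. \<Sum>i\<in>I. f i y * c i vs) x vs
    = (\<Sum>j<length vs. \<Sum>i\<in>I. (- 1) ^ j * dir_deriv (vs ! j) (f i) x * c i (nths vs (- {j})))"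
    by (simp add: ext_deriv_def sum_distrib_left mult.assoc)
  also have "\<dots> = (\<Sum>i\<in>I. cov_wedge (\<lambda>v. dir_deriv v (f i) x) (c i) vs)"
    by (subst sum.swap) (simp add: cov_wedge_eq_sum)
  finally show ?thesis .
qed

lemma smooth_form_combination:
  assumes f: "\<And>i. i \<in> I \<Longrightarrow> smooth_on UNIV (f i)"
    and c: "\<And>i. i \<in> I \<Longrightarrow> alternating k (c i)"
  shows "smooth_form M k (\<lambda>x vs. \<Sum>i\<in>I. f i x * c i vs)"
proof -
  have "c i (us @ (a *\<^sub>R v + b *\<^sub>R w) # ws) = a * c i (us @ v # ws) + b * c i (us @ w # ws)"
    if "i \<in> I" for i us ws v w a b
    using linear_alternating[OF c[OF that], of us ws] by (simp add: linear_iff)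
  then have "(\<Sum>i\<in>I. f i x * c i (us @ (a *\<^sub>R v + b *\<^sub>R w) # ws))
      = a * (\<Sum>i\<in>I. f i x * c i (us @ v # ws)) + b * (\<Sum>i\<in>I. f i x * c i (us @ w # ws))"
    for x us ws v w a b
    by (simp add: distrib_left sum.distrib sum_distrib_left mult.left_commute)
  moreover have "smooth_on UNIV (\<lambda>x. \<Sum>i\<in>I. f i x * c i vs)" for vs
    using f by (intro smooth_on_sum smooth_on_mult smooth_on_const)
  then have "smooth_on M (\<lambda>x. \<Sum>i\<in>I. f i x * c i vs)" for vs
    by (rule smooth_on_subset) simp
  ultimately show ?thesis
    unfolding smooth_form_def using alternating_length[OF c] alternating_repeat[OF c]
    by (auto intro!: sum.neutral)
qed

section \<open>The Maxwell manifold\<close>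

lemma linear_x_of: "linear x_of"
  by (auto intro!: linearI simp: x_of_def)

lemma linear_x_coord: "linear (\<lambda>m. x_of m $ \<mu>)"
  by (auto intro!: linearI simp: x_of_def)

lemma linear_A_coord: "linear (A_coord \<mu>)"
  by (auto intro!: linearI simp: A_coord_def)

lemma linear_e_coord: "linear e_coord"
  by (auto intro!: linearI simp: e_coord_def)

lemma linear_pi_coord: "linear (pi_coord \<mu> \<nu>)"
  by (auto intro!: linearI simp: pi_coord_def)

lemma coords_Pair [simp]:
  "x_of (x, A, e, p) = x" "A_coord \<mu> (x, A, e, p) = A $ \<mu>"
  "e_coord (x, A, e, p) = e" "pi_coord \<mu> \<nu> (x, A, e, p) = p $ \<mu> $ \<nu>"
  by (simp_all add: x_of_def A_coord_def e_coord_def pi_coord_def)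

lemma subspace_M_Maxwell: "subspace M_Maxwell"
proof (rule subspaceI)
  fix m m' assume "m \<in> M_Maxwell" "m' \<in> M_Maxwell"
  then have "(pi_coord \<mu> \<nu> m + pi_coord \<nu> \<mu> m) + (pi_coord \<mu> \<nu> m' + pi_coord \<nu> \<mu> m') = 0" for \<mu> \<nu>
    by (simp add: M_Maxwell_def)
  then show "m + m' \<in> M_Maxwell"
    by (simp add: M_Maxwell_def linear_add[OF linear_pi_coord] algebra_simps)
next
  fix c m assume "m \<in> M_Maxwell"
  then show "c *\<^sub>R m \<in> M_Maxwell"
    by (simp add: M_Maxwell_def linear_cmul[OF linear_pi_coord] flip: distrib_left)
qed (simp add: M_Maxwell_def linear_0[OF linear_pi_coord])

section \<open>The volume form and its contractions\<close>

definition vol :: "ddw list \<Rightarrow> real" where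
  "vol = cov_wedge (\<lambda>v. x_of v $ 1) (cov_wedge (\<lambda>v. x_of v $ 2)
    (cov_wedge (\<lambda>v. x_of v $ 3) (covector (\<lambda>v. x_of v $ 4))))"

text \<open>The vector \<open>(axis \<nu> 1, 0)\<close> is the value of
  \<open>partial_x \<nu>\<close>; its \<open>0\<close> is the zero of all remaining factors at
  once.\<close>

definition vol1 :: "4 \<Rightarrow> ddw list \<Rightarrow> real" where
  "vol1 \<nu> vs = vol ((axis \<nu> 1, 0) # vs)"

text \<open>As in \<open>dy2\<close>, the index \<open>\<nu>\<close> is contracted first and so
  occupies the first slot of \<open>vol\<close>.\<close>

definition vol2 :: "4 \<Rightarrow> 4 \<Rightarrow> ddw list \<Rightarrow> real" where
  "vol2 \<mu> \<nu> vs = vol1 \<nu> ((axis \<mu> 1, 0) # vs)"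

lemma alternating_vol: "alternating 4 vol"
proof -
  have "alternating (Suc (Suc (Suc 1))) vol"
    unfolding vol_def
    by (intro alternating_cov_wedge alternating_covector linear_x_coord)
  then show ?thesis
    by (simp add: eval_nat_numeral)
qed

lemma alternating_vol1: "alternating 3 (vol1 \<nu>)"
  using alternating_contract[OF alternating_vol, of "(axis \<nu> 1, 0)"]
  by (simp add: vol1_def[abs_def])

lemma vol_vertical:
  assumes "x_of v = 0"
  shows "vol (v # vs) = 0"
  using assms by (simp add: vol_def covector_eq_cov_wedge)

lemma vol1_vertical:
  assumes "x_of v = 0"
  shows "vol1 \<nu> (v # vs) = 0"
  using vol_vertical[OF assms] alternating_swap[OF alternating_vol, of "(axis \<nu> 1, 0)" v vs]
  by (simp add: vol1_def)

text \<open>Every \<open>dx\<close> already occurs in \<open>vol\<close>, and a repeated covector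
  kills a product.\<close>

lemma dx_wedge_vol: "cov_wedge (\<lambda>v. x_of v $ \<kappa>) vol vs = 0"
  using exhaust_4[of \<kappa>] unfolding vol_def covector_eq_cov_wedge
  by (elim disjE) (simp_all add: cov_wedge_eq_0)

text \<open>Contract \<open>dx_wedge_vol\<close> with the coordinate vector of \<open>\<nu>\<close>;
  the antiderivation rule yields the Kronecker term.\<close>

lemma dx_wedge_vol1:
  "cov_wedge (\<lambda>v. x_of v $ \<kappa>) (vol1 \<nu>) vs = (if \<kappa> = \<nu> then vol vs else 0)"
  using dx_wedge_vol[of \<kappa> "(axis \<nu> 1, 0) # vs"]
  by (auto simp: vol1_def[abs_def] x_of_def axis_def zero_prod_def split: if_splits)

text \<open>Contract the preceding identity once more, along \<open>\<mu>\<close>; the subtracted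
  term comes from the \<open>vol\<close> on its right-hand side.\<close>

lemma dx_wedge_vol2:
  "cov_wedge (\<lambda>v. x_of v $ \<kappa>) (vol2 \<mu> \<nu>) vs
    = (if \<kappa> = \<mu> then vol1 \<nu> vs else 0) - (if \<kappa> = \<nu> then vol1 \<mu> vs else 0)"
  using dx_wedge_vol1[of \<kappa> \<nu> "(axis \<mu> 1, 0) # vs"]
  by (auto simp: vol2_def[abs_def] vol1_def[of _ vs] x_of_def axis_def zero_prod_def split: if_splits)

section \<open>The given forms as products of covectors\<close>

lemma dx_eq: "dx \<mu> m = covector (\<lambda>v. x_of v $ \<mu>)"
  by (simp add: dx_def ext_deriv_fun_linear linear_x_coord)

lemma dA_eq: "dA \<mu> m = covector (A_coord \<mu>)"
  by (simp add: dA_def ext_deriv_fun_linear linear_A_coord)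

lemma de_eq: "de m = covector e_coord"
  by (simp add: de_def ext_deriv_fun_linear linear_e_coord)

lemma dpi_eq: "dpi \<mu> \<nu> m = covector (pi_coord \<mu> \<nu>)"
  by (simp add: dpi_def ext_deriv_fun_linear linear_pi_coord)

lemma dy_eq: "dy m = vol"
  by (simp add: dy_def vol_def wedge_covector[OF dx_eq] dx_eq)

lemma dy1_eq: "dy1 \<nu> m = vol1 \<nu>"
  by (simp add: fun_eq_iff dy1_def vol1_def interior_prod_def partial_x_def dy_eq zero_prod_def)

lemma dy2_eq: "dy2 \<mu> \<nu> m = vol2 \<mu> \<nu>"
  by (simp add: fun_eq_iff dy2_def vol1_def vol2_def interior_prod_def partial_x_def dy_eq
      zero_prod_def)

text \<open>Collects the sum into a single covector at each point, as \<open>wedge_covector\<close>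
  requires.\<close>

lemma A_form_eq: "A_form m = covector (\<lambda>v. \<Sum>\<mu>\<in>UNIV. A_coord \<mu> m * x_of v $ \<mu>)"
  by (auto simp: fun_eq_iff A_form_def sum_apply scale_form_def dx_eq covector_def
      split: list.split)

lemma Omega_DDW_eq:
  "Omega_DDW m vs = cov_wedge e_coord vol vs
    + (\<Sum>\<mu>\<in>UNIV. \<Sum>\<nu>\<in>UNIV. cov_wedge (pi_coord \<mu> \<nu>) (cov_wedge (A_coord \<mu>) (vol1 \<nu>)) vs)"
  by (simp add: Omega_DDW_def sum_apply wedge_covector[OF de_eq] wedge_covector[OF dpi_eq]
      wedge_covector[OF dA_eq] dy_eq dy1_eq)

lemma smooth_form_Omega_DDW: "smooth_form M 5 Omega_DDW"
proof -
  have 5: "5 = Suc 4" "4 = Suc 3" by simp_all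
  have "alternating 5 (\<lambda>vs. Omega_DDW 0 vs)"
    unfolding Omega_DDW_eq
    by (intro alternating_add alternating_sum)
      (simp_all only: 5(1) 5(2) alternating_cov_wedge linear_e_coord linear_pi_coord
        linear_A_coord alternating_vol[unfolded 5(2)] alternating_vol1)
  \<comment> \<open>The coefficients are constant, so the value at \<open>0\<close> represents the
    form everywhere; it is viewed as a combination with the single index \<open>()\<close>.\<close>
  then have "smooth_form M 5 (\<lambda>m vs. \<Sum>i\<in>{()}. 1 * Omega_DDW 0 vs)"
    by (intro smooth_form_combination smooth_on_const)
  moreover have "(\<lambda>m vs. \<Sum>i\<in>{()}. 1 * Omega_DDW 0 vs) = Omega_DDW"
    by (simp add: fun_eq_iff Omega_DDW_eq)
  ultimately show ?thesis
    by simp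
qed

text \<open>A vertical vector annihilates \<open>vol\<close> and \<open>vol1\<close>, so only the
  fibre covectors receive it; passing \<open>pi_coord\<close> causes the minus sign.\<close>

lemma Omega_DDW_vertical:
  assumes "x_of v = 0"
  shows "Omega_DDW m (v # vs) = e_coord v * vol vs
    + (\<Sum>\<mu>\<in>UNIV. \<Sum>\<nu>\<in>UNIV. pi_coord \<mu> \<nu> v * cov_wedge (A_coord \<mu>) (vol1 \<nu>) vs
        - A_coord \<mu> v * cov_wedge (pi_coord \<mu> \<nu>) (vol1 \<nu>) vs)"
  by (simp add: Omega_DDW_eq vol_vertical[OF assms] vol1_vertical[OF assms] cov_wedge_scale_right)

section \<open>Currents and their differentials\<close>

definition current ::
    "(4 \<Rightarrow> 4 \<Rightarrow> spacetime \<Rightarrow> real) \<Rightarrow> (4 \<Rightarrow> 4 \<Rightarrow> ddw \<Rightarrow> real) \<Rightarrow> ddw form" where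
  "current f L = (\<lambda>m vs. \<Sum>\<mu>\<in>UNIV. \<Sum>\<nu>\<in>UNIV. f \<mu> \<nu> (x_of m) * L \<mu> \<nu> m * vol1 \<nu> vs)"

text \<open>Pairs the two indices, since the lemmas on combinations use a single sum.\<close>

lemma current_eq_combination:
  "current f L = (\<lambda>m vs. \<Sum>i\<in>UNIV. (case i of (\<mu>, \<nu>) \<Rightarrow> f \<mu> \<nu> (x_of m) * L \<mu> \<nu> m) * vol1 (snd i) vs)"
  by (simp add: current_def sum.cartesian_product case_prod_unfold)

lemma P_form_eq_current: "P_form \<phi> = current (\<lambda>\<mu> \<nu>. \<phi> \<mu>) pi_coord"
  by (simp add: fun_eq_iff P_form_def current_def sum_apply scale_form_def dy1_eq)

lemma Q_form_eq_current:
  assumes "\<And>\<mu> \<nu> x. \<psi> \<mu> \<nu> x = - \<psi> \<nu> \<mu> x"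
  shows "Q_form \<psi> = current \<psi> (\<lambda>\<mu> \<nu>. A_coord \<mu>)"
proof (intro ext)
  fix m vs
  let ?t = "\<lambda>\<mu> \<nu>. \<psi> \<mu> \<nu> (x_of m) * A_coord \<mu> m * vol1 \<nu> vs"
  have wedge: "(A_form \<and>\<^sub>F dy2 \<mu> \<nu>) m vs = A_coord \<mu> m * vol1 \<nu> vs - A_coord \<nu> m * vol1 \<mu> vs" for \<mu> \<nu>
    by (simp add: wedge_covector[OF A_form_eq] dy2_eq cov_wedge_sum_left cov_wedge_scale_left
        dx_wedge_vol2 right_diff_distrib sum_subtractf if_distrib[of "\<lambda>c. _ * c"] cong: if_cong)
  \<comment> \<open>Skewness makes the second term the first with its indices exchanged, so the two
    halves add up after summation.\<close>
  have "1 / 2 * \<psi> \<mu> \<nu> (x_of m) * (A_form \<and>\<^sub>F dy2 \<mu> \<nu>) m vs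
      = 1 / 2 * ?t \<mu> \<nu> + 1 / 2 * ?t \<nu> \<mu>" for \<mu> \<nu>
    unfolding wedge using assms[of \<nu> \<mu> "x_of m"] by (simp add: algebra_simps)
  then have "Q_form \<psi> m vs = (\<Sum>\<mu>\<in>UNIV. \<Sum>\<nu>\<in>UNIV. 1 / 2 * ?t \<mu> \<nu> + 1 / 2 * ?t \<nu> \<mu>)"
    by (simp add: Q_form_def sum_apply scale_form_def add_divide_distrib)
  also have "\<dots> = 1 / 2 * (\<Sum>\<mu>\<in>UNIV. \<Sum>\<nu>\<in>UNIV. ?t \<mu> \<nu>) + 1 / 2 * (\<Sum>\<mu>\<in>UNIV. \<Sum>\<nu>\<in>UNIV. ?t \<nu> \<mu>)"
    by (simp only: sum.distrib sum_distrib_left)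
  also have "(\<Sum>\<mu>\<in>UNIV. \<Sum>\<nu>\<in>UNIV. ?t \<nu> \<mu>) = (\<Sum>\<mu>\<in>UNIV. \<Sum>\<nu>\<in>UNIV. ?t \<mu> \<nu>)"
    by (rule sum.swap)
  finally show "Q_form \<psi> m vs = current \<psi> (\<lambda>\<mu> \<nu>. A_coord \<mu>) m vs"
    by (simp add: current_def)
qed

context
  fixes f :: "4 \<Rightarrow> 4 \<Rightarrow> spacetime \<Rightarrow> real" and L :: "4 \<Rightarrow> 4 \<Rightarrow> ddw \<Rightarrow> real"
  assumes f: "\<And>\<mu> \<nu>. smooth_on UNIV (f \<mu> \<nu>)" and L: "\<And>\<mu> \<nu>. linear (L \<mu> \<nu>)"
begin

lemma smooth_on_current_coeff: "smooth_on UNIV (\<lambda>m. f \<mu> \<nu> (x_of m) * L \<mu> \<nu> m)"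
  by (intro smooth_on_mult smooth_on_compose_linear[of x_of] linear_x_of f smooth_on_linear L)

lemma smooth_form_current: "smooth_form M 3 (current f L)"
  unfolding current_eq_combination
  by (intro smooth_form_combination)
    (auto simp: smooth_on_current_coeff alternating_vol1 split: prod.split)

lemma dir_deriv_current_coeff:
  "dir_deriv v (\<lambda>m. f \<mu> \<nu> (x_of m) * L \<mu> \<nu> m) m = f \<mu> \<nu> (x_of m) * L \<mu> \<nu> v
    + (\<Sum>\<kappa>\<in>UNIV. L \<mu> \<nu> m * dir_deriv (axis \<kappa> 1) (f \<mu> \<nu>) (x_of m) * x_of v $ \<kappa>)"
proof -
  have "dir_deriv v (\<lambda>m. f \<mu> \<nu> (x_of m) * L \<mu> \<nu> m) m
      = f \<mu> \<nu> (x_of m) * dir_deriv v (L \<mu> \<nu>) m + dir_deriv v (\<lambda>m. f \<mu> \<nu> (x_of m)) m * L \<mu> \<nu> m"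
    by (intro dir_deriv_mult smooth_on_differentiable smooth_on_compose_linear[of x_of]
        linear_x_of f smooth_on_linear L)
  moreover have "dir_deriv v (L \<mu> \<nu>) m = L \<mu> \<nu> v"
    using L by (simp add: dir_deriv_linear linear_conv_bounded_linear)
  moreover have "dir_deriv v (\<lambda>m. f \<mu> \<nu> (x_of m)) m
      = (\<Sum>\<kappa>\<in>UNIV. x_of v $ \<kappa> * dir_deriv (axis \<kappa> 1) (f \<mu> \<nu>) (x_of m))"
    using smooth_on_differentiable[OF f] linear_x_of
    by (simp add: dir_deriv_compose_linear flip: dir_deriv_axis)
  ultimately show ?thesis
    by (simp add: sum_distrib_left mult_ac)
qed

lemma ext_deriv_current:
  "ext_deriv (current f L) m vs
    = (\<Sum>\<mu>\<in>UNIV. \<Sum>\<nu>\<in>UNIV. L \<mu> \<nu> m * dir_deriv (axis \<nu> 1) (f \<mu> \<nu>) (x_of m) * vol vs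
        + f \<mu> \<nu> (x_of m) * cov_wedge (L \<mu> \<nu>) (vol1 \<nu>) vs)"
proof -
  have "ext_deriv (current f L) m vs
      = (\<Sum>i\<in>UNIV. cov_wedge (\<lambda>v. dir_deriv v (\<lambda>m. case i of (\<mu>, \<nu>) \<Rightarrow> f \<mu> \<nu> (x_of m) * L \<mu> \<nu> m) m)
          (vol1 (snd i)) vs)"
    unfolding current_eq_combination
    by (rule ext_deriv_combination)
      (auto intro: smooth_on_differentiable smooth_on_current_coeff split: prod.split)
  also have "\<dots> = (\<Sum>\<mu>\<in>UNIV. \<Sum>\<nu>\<in>UNIV.
      cov_wedge (\<lambda>v. dir_deriv v (\<lambda>m. f \<mu> \<nu> (x_of m) * L \<mu> \<nu> m) m) (vol1 \<nu>) vs)"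
    by (simp add: sum.cartesian_product case_prod_unfold)
  also have "\<dots> = (\<Sum>\<mu>\<in>UNIV. \<Sum>\<nu>\<in>UNIV. L \<mu> \<nu> m * dir_deriv (axis \<nu> 1) (f \<mu> \<nu>) (x_of m) * vol vs
        + f \<mu> \<nu> (x_of m) * cov_wedge (L \<mu> \<nu>) (vol1 \<nu>) vs)"
    \<comment> \<open>\<open>dx_wedge_vol1\<close> retains only the partial derivatives with
      \<open>\<kappa> = \<nu>\<close>, a divergence.\<close>
    unfolding dir_deriv_current_coeff
    by (simp add: cov_wedge_add_left cov_wedge_sum_left cov_wedge_scale_left dx_wedge_vol1
        add.commute if_distrib[of "\<lambda>c. _ * c"] cong: if_cong)
  finally show ?thesis .
qed

text \<open>The vector survives only in the slot of \<open>L\<close>. This evaluates all brackets,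
  leaving no derivative of \<open>f\<close>.\<close>

lemma ext_deriv_current_vertical:
  assumes "x_of v = 0"
  shows "ext_deriv (current f L) m (v # vs)
    = (\<Sum>\<mu>\<in>UNIV. \<Sum>\<nu>\<in>UNIV. f \<mu> \<nu> (x_of m) * L \<mu> \<nu> v * vol1 \<nu> vs)"
  by (simp add: ext_deriv_current vol_vertical[OF assms] vol1_vertical[OF assms] mult.assoc)

end

section \<open>Hamiltonian vector fields\<close>

definition P_field :: "(4 \<Rightarrow> spacetime \<Rightarrow> real) \<Rightarrow> ddw \<Rightarrow> ddw" where
  "P_field \<phi> m = (0, \<chi> \<mu>. \<phi> \<mu> (x_of m),
    - (\<Sum>\<mu>\<in>UNIV. \<Sum>\<nu>\<in>UNIV. pi_coord \<mu> \<nu> m * dir_deriv (axis \<nu> 1) (\<phi> \<mu>) (x_of m)), 0)"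

definition Q_field :: "(4 \<Rightarrow> 4 \<Rightarrow> spacetime \<Rightarrow> real) \<Rightarrow> ddw \<Rightarrow> ddw" where
  "Q_field \<psi> m = (0, 0,
    - (\<Sum>\<mu>\<in>UNIV. \<Sum>\<nu>\<in>UNIV. A_coord \<mu> m * dir_deriv (axis \<nu> 1) (\<psi> \<mu> \<nu>) (x_of m)),
    \<chi> \<mu> \<nu>. - \<psi> \<mu> \<nu> (x_of m))"

lemma smooth_on_P_field:
  assumes "\<And>\<mu>. smooth_on UNIV (\<phi> \<mu>)"
  shows "smooth_on UNIV (P_field \<phi>)"
proof (rule smooth_on_componentwise)
  fix b :: ddw assume "b \<in> Basis"
  then show "smooth_on UNIV (\<lambda>m. P_field \<phi> m \<bullet> b)"
    by (auto simp: P_field_def Basis_prod_def Basis_vec_def inner_axis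
      intro!: smooth_on_const smooth_on_minus smooth_on_sum smooth_on_mult
        smooth_on_compose_linear[OF linear_x_of] assms smooth_on_dir_deriv
        smooth_on_linear[OF linear_pi_coord])
qed

lemma smooth_on_Q_field:
  assumes "\<And>\<mu> \<nu>. smooth_on UNIV (\<psi> \<mu> \<nu>)"
  shows "smooth_on UNIV (Q_field \<psi>)"
proof (rule smooth_on_componentwise)
  fix b :: ddw assume "b \<in> Basis"
  then show "smooth_on UNIV (\<lambda>m. Q_field \<psi> m \<bullet> b)"
    by (auto simp: Q_field_def Basis_prod_def Basis_vec_def inner_axis
      intro!: smooth_on_const smooth_on_minus smooth_on_sum smooth_on_mult
        smooth_on_compose_linear[OF linear_x_of] assms smooth_on_dir_deriv
        smooth_on_linear[OF linear_A_coord])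
qed

lemma hamiltonian_field_P:
  assumes \<phi>: "\<And>\<mu>. smooth_on UNIV (\<phi> \<mu>)"
  shows "hamiltonian_field M_Maxwell Omega_DDW (P_form \<phi>) (P_field \<phi>)"
proof -
  \<comment> \<open>Proved on the whole ambient space, which covers the Maxwell subspace.\<close>
  have "Omega_DDW m (P_field \<phi> m # vs) + ext_deriv (P_form \<phi>) m vs = 0" for m vs
  proof -
    have "x_of (P_field \<phi> m) = 0"
      by (simp add: P_field_def)
    then show ?thesis
      \<comment> \<open>The field stays folded until the contraction is expanded. Then its
        \<open>e\<close>-component cancels the divergence, and its \<open>A\<close>-components
        cancel the products with \<open>pi_coord\<close>.\<close>
      by (simp add: Omega_DDW_vertical P_form_eq_current ext_deriv_current \<phi> linear_pi_coord)
        (simp add: P_field_def sum.distrib sum_subtractf sum_negf sum_distrib_right)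
  qed
  moreover have "P_field \<phi> m \<in> M_Maxwell" for m
    by (simp add: P_field_def M_Maxwell_def)
  ultimately show ?thesis
    using smooth_on_subset[OF smooth_on_P_field[OF \<phi>]]
    by (simp add: hamiltonian_field_def form_eq_on_def interior_prod_def)
qed

lemma hamiltonian_field_Q:
  assumes \<psi>: "\<And>\<mu> \<nu>. smooth_on UNIV (\<psi> \<mu> \<nu>)"
    and skew: "\<And>\<mu> \<nu> x. \<psi> \<mu> \<nu> x = - \<psi> \<nu> \<mu> x"
  shows "hamiltonian_field M_Maxwell Omega_DDW (Q_form \<psi>) (Q_field \<psi>)"
proof -
  have "Omega_DDW m (Q_field \<psi> m # vs) + ext_deriv (Q_form \<psi>) m vs = 0" for m vs
  proof -
    have "x_of (Q_field \<psi> m) = 0"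
      by (simp add: Q_field_def)
    then show ?thesis
      \<comment> \<open>Here the \<pi>-components cancel the products with
        \<open>A_coord\<close>.\<close>
      by (simp add: Omega_DDW_vertical Q_form_eq_current[of \<psi>, OF skew] ext_deriv_current \<psi> linear_A_coord)
        (simp add: Q_field_def sum.distrib sum_subtractf sum_negf sum_distrib_right)
  qed
  moreover have "Q_field \<psi> m \<in> M_Maxwell" for m
  proof -
    have "pi_coord \<mu> \<nu> (Q_field \<psi> m) + pi_coord \<nu> \<mu> (Q_field \<psi> m) = 0" for \<mu> \<nu>
      using skew[of \<mu> \<nu> "x_of m"] by (simp add: Q_field_def)
    then show ?thesis
      by (simp add: M_Maxwell_def)
  qed
  ultimately show ?thesis
    using smooth_on_subset[OF smooth_on_Q_field[of \<psi>, OF \<psi>]]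
    by (simp add: hamiltonian_field_def form_eq_on_def interior_prod_def)
qed

theorem proposition2p1:
  fixes \<phi> \<phi>' :: "4 \<Rightarrow> spacetime \<Rightarrow> real"
    and \<psi> \<psi>' :: "4 \<Rightarrow> 4 \<Rightarrow> spacetime \<Rightarrow> real"
  assumes "\<And>\<mu>. smooth_on UNIV (\<phi> \<mu>)" and "\<And>\<mu>. smooth_on UNIV (\<phi>' \<mu>)"
    and "\<And>\<mu> \<nu>. smooth_on UNIV (\<psi> \<mu> \<nu>)" and "\<And>\<mu> \<nu>. smooth_on UNIV (\<psi>' \<mu> \<nu>)"
    and "\<And>\<mu> \<nu> x. \<psi> \<mu> \<nu> x = - \<psi> \<nu> \<mu> x" and "\<And>\<mu> \<nu> x. \<psi>' \<mu> \<nu> x = - \<psi>' \<nu> \<mu> x"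
  shows "algebraic_observable 4 M_Maxwell Omega_DDW (P_form \<phi>) \<and>
    algebraic_observable 4 M_Maxwell Omega_DDW (P_form \<phi>') \<and>
    algebraic_observable 4 M_Maxwell Omega_DDW (Q_form \<psi>) \<and>
    algebraic_observable 4 M_Maxwell Omega_DDW (Q_form \<psi>') \<and>
    form_eq_on M_Maxwell (poisson_bracket M_Maxwell Omega_DDW (Q_form \<psi>) (Q_form \<psi>')) 0 \<and>
    form_eq_on M_Maxwell (poisson_bracket M_Maxwell Omega_DDW (P_form \<phi>) (P_form \<phi>')) 0 \<and>
    form_eq_on M_Maxwell (poisson_bracket M_Maxwell Omega_DDW (Q_form \<psi>) (P_form \<phi>))
      (- (\<Sum>\<mu>\<in>UNIV. \<Sum>\<nu>\<in>UNIV. (\<lambda>m. \<psi> \<mu> \<nu> (x_of m) * \<phi> \<mu> (x_of m)) *\<^sub>F dy1 \<nu>))"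
proof (intro conjI)
  let ?M = M_Maxwell and ?\<Omega> = Omega_DDW
  note \<phi> = assms(1) and \<phi>' = assms(2) and \<psi> = assms(3) and \<psi>' = assms(4)
  note HP = hamiltonian_field_P[of \<phi>, OF \<phi>] and HP' = hamiltonian_field_P[of \<phi>', OF \<phi>']
  note HQ = hamiltonian_field_Q[of \<psi>, OF \<psi> assms(5)]
    and HQ' = hamiltonian_field_Q[of \<psi>', OF \<psi>' assms(6)]
  note Q = Q_form_eq_current[of \<psi>, OF assms(5)] and Q' = Q_form_eq_current[of \<psi>', OF assms(6)]
  \<comment> \<open>Replaces the field picked by \<open>SOME\<close> with the explicit field of the
    first observable.\<close>
  note bracket = poisson_bracket_eq(1)[OF smooth_form_Omega_DDW subspace_M_Maxwell]
  show "algebraic_observable 4 ?M ?\<Omega> (P_form \<phi>)" "algebraic_observable 4 ?M ?\<Omega> (P_form \<phi>')"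
    using HP HP' \<phi> \<phi>'
    by (auto simp: algebraic_observable_def P_form_eq_current smooth_form_current linear_pi_coord)
  show "algebraic_observable 4 ?M ?\<Omega> (Q_form \<psi>)" "algebraic_observable 4 ?M ?\<Omega> (Q_form \<psi>')"
    using HQ HQ' \<psi> \<psi>'
    by (auto simp: algebraic_observable_def Q Q' smooth_form_current linear_A_coord)
  have vertical: "x_of (P_field \<phi> m) = 0" "x_of (Q_field \<psi> m) = 0" for m
    by (simp_all add: P_field_def Q_field_def)
  \<comment> \<open>On vertical vectors the differential of \<open>Q_form \<psi>'\<close> reads only
    \<open>A\<close>-components, and \<open>Q_field\<close> has none.\<close>
  show "form_eq_on ?M (poisson_bracket ?M ?\<Omega> (Q_form \<psi>) (Q_form \<psi>')) 0"
    using bracket[OF HQ HQ'] \<psi>'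
    by (simp add: form_eq_on_def interior_prod_def Q' ext_deriv_current_vertical vertical
        linear_A_coord) (simp add: Q_field_def)
  \<comment> \<open>Likewise only \<pi>-components are read, which vanish for
    \<open>P_field\<close>.\<close>
  show "form_eq_on ?M (poisson_bracket ?M ?\<Omega> (P_form \<phi>) (P_form \<phi>')) 0"
    using bracket[OF HP HP'] \<phi>'
    by (simp add: form_eq_on_def interior_prod_def P_form_eq_current ext_deriv_current_vertical
        vertical linear_pi_coord) (simp add: P_field_def)
  \<comment> \<open>The \<pi>-components of \<open>Q_field\<close> are
    \<open>- \<psi> \<mu> \<nu>\<close>, whence the sign.\<close>
  show "form_eq_on ?M (poisson_bracket ?M ?\<Omega> (Q_form \<psi>) (P_form \<phi>))
      (- (\<Sum>\<mu>\<in>UNIV. \<Sum>\<nu>\<in>UNIV. (\<lambda>m. \<psi> \<mu> \<nu> (x_of m) * \<phi> \<mu> (x_of m)) *\<^sub>F dy1 \<nu>))"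
    using bracket[OF HQ HP] \<phi>
    by (simp add: form_eq_on_def interior_prod_def P_form_eq_current ext_deriv_current_vertical
        vertical linear_pi_coord sum_apply scale_form_def dy1_eq)
      (simp add: Q_field_def sum_negf mult.commute)
qed

end
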